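(* Let $T$ be a tree of order $n$ with $m = n-1$ edges, maximum degree $\Delta$, and non-decreasing degree sequence $\mathscr{D} = (d_1, \dots, d_n)$ whose average entry is $\lambda_{\mathscr{D}}$. Let $\eta = \left\lceil \frac{2n\Delta}{m} \right\rceil$ and let $\eta_1$ be an integer with $2 < \eta_1 \leqslant 4$. Then \[ \sigma(T) \leqslant \eta_1 \left\lfloor \frac{n}{n - \eta} \right\rfloor + \eta_1 \left\lceil \frac{n}{\eta - \lambda_{\mathscr{D}}} \right\rceil + \sum_{v \in V(T)} \deg_T(v)^3 . \]
   Context: The Sigma index of a graph $G$ is $\sigma(G) = \sum_{uv \in E(G)} (\deg_G(u) - \deg_G(v))^2$. *)

theory Defs
  imports Complex_Main "HOL-Library.Multiset" "Graph_Theory.Digraph_Component"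
begin

text \<open>
  A finite simple graph is an instance of the locale \<^locale>\<open>graph\<close>: a finite symmetric digraph
  without loops and without parallel arcs, so that every edge \<open>uv\<close> is represented by the two arcs
  from \<open>u\<close> to \<open>v\<close> and from \<open>v\<close> to \<open>u\<close>. The degree of a vertex is its \<^const>\<open>out_degree\<close>.
\<close>

definition edges :: "('a, 'b) pre_digraph \<Rightarrow> 'a set set" where
  "edges G = (\<lambda>a. {tail G a, head G a}) ` arcs G"

text \<open>
  \<^const>\<open>tree\<close> and \<^const>\<open>forest\<close> count the closed walk \<open>u, v, u\<close> along a single edge as a
  cycle, and hence cannot be used for symmetric digraphs. In a simple graph the remaining cycles
  have length at least 3, and these are the cycles in the usual undirected sense.
\<close>

definition undirected_tree :: "('a, 'b) pre_digraph \<Rightarrow> bool" where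
  "undirected_tree G \<longleftrightarrow>
     graph G \<and> Digraph_Component.connected G \<and> (\<nexists>p. pre_digraph.cycle G p \<and> length p \<ge> 3)"

definition max_degree :: "('a, 'b) pre_digraph \<Rightarrow> nat" where
  "max_degree G = Max (out_degree G ` verts G)"

definition degree_sequence :: "('a, 'b) pre_digraph \<Rightarrow> nat list" where
  "degree_sequence G = sorted_list_of_multiset (image_mset (out_degree G) (mset_set (verts G)))"

definition average :: "nat list \<Rightarrow> real" where
  "average ds = real (sum_list ds) / real (length ds)"

text \<open>The description below is well defined because the squared difference is symmetric.\<close>

definition edge_imbalance_sq :: "('a, 'b) pre_digraph \<Rightarrow> 'a set \<Rightarrow> int" where
  "edge_imbalance_sq G e =
     (THE x. \<forall>u v. e = {u, v} \<longrightarrow> x = (int (out_degree G u) - int (out_degree G v))\<^sup>2)"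

definition sigma_index :: "('a, 'b) pre_digraph \<Rightarrow> int" where
  "sigma_index G = (\<Sum>e\<in>edges G. edge_imbalance_sq G e)"

lemma edge_imbalance_sq_doubleton:
  "edge_imbalance_sq G {u, v} = (int (out_degree G u) - int (out_degree G v))\<^sup>2"
  unfolding edge_imbalance_sq_def
  by (rule the_equality) (auto simp: doubleton_eq_iff power2_commute)

end

theory Submission
  imports Defs
begin

text \<open>
  Expanding the squares gives \<open>\<sigma>(T) = \<Sum> deg\<^sup>3 - 2 M\<close> with \<open>M = \<Sum>\<^bsub>uv\<^esub> deg u deg v\<close>. From
  \<open>(deg u - 1)(deg v - 1) \<ge> 0\<close> and \<open>(deg v - 1)(deg v - 2) \<ge> 0\<close> one gets
  \<open>M \<ge> 5 m - 2 n = 3 m - 2\<close>. The only negative contribution to the right-hand side is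
  \<open>\<eta>\<^sub>1 \<lfloor>n / (n - \<eta>)\<rfloor> \<ge> -\<eta>\<^sub>1 n\<close>, which the second summand, at least \<open>\<eta>\<^sub>1\<close>, and \<open>2 M\<close> absorb;
  for \<open>m = 1\<close> the floor is at least \<open>-1\<close>.
\<close>

text \<open>Without parallel arcs \<open>arc_to_ends G\<close> is injective, so arcs can be replaced
  by ordered pairs of endpoints. All double counting below runs over these pairs.\<close>

lemma (in graph) out_degree_eq_card_arcs_ends:
  "out_degree G u = card {p \<in> arcs_ends G. fst p = u}"
proof -
  have "{p \<in> arcs_ends G. fst p = u} = arc_to_ends G ` out_arcs G u"
    by (auto simp: arcs_ends_def arc_to_ends_def out_arcs_def)
  moreover have "inj_on (arc_to_ends G) (out_arcs G u)"
    using no_multi_arcs by (auto simp: inj_on_def out_arcs_def)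
  ultimately show ?thesis
    by (simp add: out_degree_def card_image)
qed

text \<open>Group the pairs by first component: the fibre over \<open>v\<close> has
  \<open>out_degree G v\<close> elements.\<close>

lemma (in graph) sum_arcs_ends_fst:
  fixes h :: "'a \<Rightarrow> int"
  shows "(\<Sum>p\<in>arcs_ends G. h (fst p)) = (\<Sum>v\<in>verts G. int (out_degree G v) * h v)"
proof -
  have "(\<Sum>p\<in>arcs_ends G. h (fst p)) =
      (\<Sum>v\<in>verts G. \<Sum>p | p \<in> arcs_ends G \<and> fst p = v. h (fst p))"
    by (rule sum.group[symmetric]) (auto simp: arcs_ends_def arc_to_ends_def)
  also have "\<dots> = (\<Sum>v\<in>verts G. int (out_degree G v) * h v)"
    by (intro sum.cong) (auto simp: out_degree_eq_card_arcs_ends)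
  finally show ?thesis .
qed

lemma (in graph) swap_image_arcs_ends: "prod.swap ` arcs_ends G = arcs_ends G"
proof -
  have "prod.swap p \<in> arcs_ends G" if "p \<in> arcs_ends G" for p
    using that sym_arcs by (cases p) (auto simp: symmetric_def dest: symD)
  then show ?thesis
    by (auto simp: image_iff) (metis swap_simp)
qed

lemma (in graph) sum_arcs_ends_snd:
  fixes h :: "'a \<Rightarrow> int"
  shows "(\<Sum>p\<in>arcs_ends G. h (snd p)) = (\<Sum>v\<in>verts G. int (out_degree G v) * h v)"
proof -
  have "(\<Sum>p\<in>arcs_ends G. h (snd p)) = (\<Sum>p\<in>prod.swap ` arcs_ends G. h (snd p))"
    by (simp add: swap_image_arcs_ends)
  also have "\<dots> = (\<Sum>p\<in>arcs_ends G. h (fst p))"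
    by (subst sum.reindex) (auto simp: inj_on_def)
  finally show ?thesis
    by (simp add: sum_arcs_ends_fst)
qed

text \<open>Each edge comes from exactly two ordered pairs: symmetry supplies both orientations, and
  the absence of loops makes them distinct.\<close>

lemma (in graph) sum_arcs_ends_eq_twice_sum_edges:
  fixes g :: "'a set \<Rightarrow> int"
  shows "(\<Sum>p\<in>arcs_ends G. g {fst p, snd p}) = 2 * (\<Sum>e\<in>edges G. g e)"
proof -
  have edges: "edges G = (\<lambda>p. {fst p, snd p}) ` arcs_ends G"
    by (auto simp: edges_def arcs_ends_def arc_to_ends_def image_image)
  have fibre: "card {p \<in> arcs_ends G. {fst p, snd p} = e} = 2" if "e \<in> edges G" for e
  proof -
    from that obtain u v where e: "e = {u, v}" and uv: "(u, v) \<in> arcs_ends G"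
      by (auto simp: edges)
    have vu: "(v, u) \<in> arcs_ends G"
      using uv swap_image_arcs_ends by (metis image_eqI swap_simp)
    have "u \<noteq> v"
      using uv no_loops by (auto simp: arcs_ends_def arc_to_ends_def)
    moreover have "{p \<in> arcs_ends G. {fst p, snd p} = e} = {(u, v), (v, u)}"
      using uv vu by (auto simp: e doubleton_eq_iff)
    ultimately show ?thesis
      by simp
  qed
  have "(\<Sum>p\<in>arcs_ends G. g {fst p, snd p}) =
      (\<Sum>e\<in>edges G. \<Sum>p | p \<in> arcs_ends G \<and> {fst p, snd p} = e. g {fst p, snd p})"
    by (rule sum.group[symmetric]) (auto simp: edges arcs_ends_def)
  also have "\<dots> = (\<Sum>e\<in>edges G. 2 * g e)"
    by (intro sum.cong refl) (simp add: fibre)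
  finally show ?thesis
    by (simp add: sum_distrib_left)
qed

lemma (in graph) handshake: "(\<Sum>v\<in>verts G. int (out_degree G v)) = 2 * int (card (edges G))"
  using sum_arcs_ends_fst[of "\<lambda>_. 1"] sum_arcs_ends_eq_twice_sum_edges[of "\<lambda>_. 1"] by simp

lemma (in graph) out_degree_pos_of_arcs_ends:
  assumes "(u, v) \<in> arcs_ends G"
  shows "out_degree G u > 0" "out_degree G v > 0"
proof -
  have pos: "out_degree G x > 0" if "(x, y) \<in> arcs_ends G" for x y
    using that by (auto simp: out_degree_eq_card_arcs_ends card_gt_0_iff arcs_ends_def)
  have "(v, u) \<in> arcs_ends G"
    using assms swap_image_arcs_ends by (metis image_eqI swap_simp)
  then show "out_degree G u > 0" "out_degree G v > 0"
    using assms pos by blast+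
qed

lemma (in graph) sigma_index_le:
  "sigma_index G \<le> (\<Sum>v\<in>verts G. int (out_degree G v) ^ 3)
     - 10 * int (card (edges G)) + 4 * int (card (verts G))"
proof -
  let ?d = "\<lambda>v. int (out_degree G v)" and ?m = "int (card (edges G))"
  have "2 * sigma_index G = (\<Sum>p\<in>arcs_ends G. edge_imbalance_sq G {fst p, snd p})"
    by (simp add: sigma_index_def sum_arcs_ends_eq_twice_sum_edges)
  \<comment> \<open>The mixed product a b of the endpoint degrees is replaced by its lower bound a +
    b - 1. The result separates into one term per endpoint, so the sum over pairs becomes a sum over
    vertices.\<close>
  also have "\<dots> \<le> (\<Sum>p\<in>arcs_ends G. ((?d (fst p))\<^sup>2 - 2 * ?d (fst p))
      + ((?d (snd p))\<^sup>2 - 2 * ?d (snd p)) + 2)"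
  proof (rule sum_mono)
    fix p assume "p \<in> arcs_ends G"
    then have "?d (fst p) \<ge> 1" "?d (snd p) \<ge> 1"
      using out_degree_pos_of_arcs_ends[of "fst p" "snd p"] by auto
    then have "0 \<le> (?d (fst p) - 1) * (?d (snd p) - 1)"
      by simp
    then show "edge_imbalance_sq G {fst p, snd p} \<le> ((?d (fst p))\<^sup>2 - 2 * ?d (fst p))
      + ((?d (snd p))\<^sup>2 - 2 * ?d (snd p)) + 2"
      by (simp add: edge_imbalance_sq_doubleton power2_eq_square algebra_simps)
  qed
  also have "\<dots> = 2 * (\<Sum>v\<in>verts G. ?d v * ((?d v)\<^sup>2 - 2 * ?d v)) + (\<Sum>p\<in>arcs_ends G. 2)"
    unfolding sum.distrib sum_arcs_ends_fst[of "\<lambda>v. (?d v)\<^sup>2 - 2 * ?d v"]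
      sum_arcs_ends_snd[of "\<lambda>v. (?d v)\<^sup>2 - 2 * ?d v"] by simp
  also have "(\<Sum>p\<in>arcs_ends G. 2) = 4 * ?m"
    using sum_arcs_ends_eq_twice_sum_edges[of "\<lambda>_. 2"] by simp
  finally have "sigma_index G \<le> (\<Sum>v\<in>verts G. ?d v * ((?d v)\<^sup>2 - 2 * ?d v)) + 2 * ?m"
    by simp
  also have "(\<Sum>v\<in>verts G. ?d v * ((?d v)\<^sup>2 - 2 * ?d v))
      \<le> (\<Sum>v\<in>verts G. ?d v ^ 3 - 6 * ?d v + 4)"
  proof (rule sum_mono)
    fix v
    \<comment> \<open>Two consecutive integers have a nonnegative product, also at isolated
      vertices. Doubled, this reads 2 d^2 \<ge> 6 d - 4, whose right-hand side is linear in d and is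
      summed by \<open>handshake\<close>.\<close>
    have "0 \<le> (?d v - 1) * (?d v - 2)"
      by (cases "?d v \<ge> 2") (auto simp: mult_nonpos_nonpos)
    then show "?d v * ((?d v)\<^sup>2 - 2 * ?d v) \<le> ?d v ^ 3 - 6 * ?d v + 4"
      by (simp add: power2_eq_square power3_eq_cube algebra_simps)
  qed
  also have "\<dots> = (\<Sum>v\<in>verts G. ?d v ^ 3) - 12 * ?m + 4 * int (card (verts G))"
    by (simp add: sum.distrib sum_subtractf sum_distrib_left[symmetric] handshake)
  finally show ?thesis
    by simp
qed

lemma average_degree_sequence:
  "average (degree_sequence G) = real (\<Sum>v\<in>verts G. out_degree G v) / real (card (verts G))"
proof -
  have "sum_list (degree_sequence G) = (\<Sum>v\<in>verts G. out_degree G v)"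
    unfolding degree_sequence_def sum_mset_sum_list[symmetric]
    by (simp add: sum_unfold_sum_mset)
  moreover have "length (degree_sequence G) = card (verts G)"
    unfolding degree_sequence_def size_mset[symmetric] by simp
  ultimately show ?thesis
    by (simp add: average_def)
qed

text \<open>Serves to show that the denominator \<open>\<eta> - lam\<close> in the theorem is
  positive.\<close>

lemma (in graph) average_degree_sequence_le_max_degree:
  assumes "verts G \<noteq> {}"
  shows "average (degree_sequence G) \<le> real (max_degree G)"
proof -
  have "(\<Sum>v\<in>verts G. out_degree G v) \<le> card (verts G) * max_degree G"
    using sum_bounded_above[of "verts G" "out_degree G" "max_degree G"]
    by (simp add: max_degree_def)
  then have "real (\<Sum>v\<in>verts G. out_degree G v) \<le> real (card (verts G)) * real (max_degree G)"
    by (metis of_nat_le_iff of_nat_mult)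
  then show ?thesis
    using assms by (simp add: average_degree_sequence divide_le_eq card_gt_0_iff mult.commute)
qed

text \<open>A negative integer denominator is at most -1, so the quotient cannot drop below -n. For
  \<open>k = 0\<close> the quotient is 0 by convention.\<close>

lemma floor_divide_of_int_ge:
  fixes k :: int
  shows "- int n \<le> \<lfloor>real n / real_of_int k\<rfloor>"
proof (cases "k \<ge> 0")
  case True
  then have "0 \<le> \<lfloor>real n / real_of_int k\<rfloor>"
    by simp
  then show ?thesis
    by linarith
next
  case False
  then have "real_of_int k \<le> -1"
    by linarith
  then have "real n * real_of_int k \<le> real n * -1"
    by (intro mult_left_mono) auto
  then have "- real n \<le> real n / real_of_int k"
    using False by (simp add: le_divide_eq)
  then show ?thesis
    by (simp add: le_floor_iff)
qed

theorem theorem5: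
  fixes T :: "('a, 'b) pre_digraph"
    and n m \<Delta> :: nat and D :: "nat list" and lam :: real and \<eta> \<eta>\<^sub>1 :: int
  assumes "undirected_tree T"
    and "n = card (verts T)"
    and "m = card (edges T)" and "m = n - 1"
    and "\<Delta> = max_degree T"
    and "D = degree_sequence T"
    and "lam = average D"
    and "\<eta> = \<lceil>2 * real n * real \<Delta> / real m\<rceil>"
    and "2 < \<eta>\<^sub>1" and "\<eta>\<^sub>1 \<le> 4"
  shows "sigma_index T \<le>
           \<eta>\<^sub>1 * \<lfloor>real n / (real n - real_of_int \<eta>)\<rfloor>
           + \<eta>\<^sub>1 * \<lceil>real n / (real_of_int \<eta> - lam)\<rceil>
           + (\<Sum>v\<in>verts T. int (out_degree T v) ^ 3)"
proof -
  interpret graph T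
    using assms(1) by (simp add: undirected_tree_def)
  let ?S = "\<Sum>v\<in>verts T. int (out_degree T v) ^ 3"
  let ?F = "\<lfloor>real n / (real n - real_of_int \<eta>)\<rfloor>"
  let ?C = "\<lceil>real n / (real_of_int \<eta> - lam)\<rceil>"
  show ?thesis
  proof (cases "m = 0")
    \<comment> \<open>Here n is at most 1. Division by zero gives \<open>\<eta> = 0\<close>, and
      since \<open>lam = 0\<close> too, the ceiling term is 0. The floor term is that of n / n,
      hence nonnegative, while the left-hand side is 0.\<close>
    case True
    have fin: "finite (edges T)"
      by (simp add: edges_def)
    have "edges T = {}"
      using True assms(3) fin by simp
    then have "sigma_index T = 0" and "(\<Sum>v\<in>verts T. int (out_degree T v)) = 0"
      using handshake by (simp_all add: sigma_index_def)
    moreover from this(2) have "(\<Sum>v\<in>verts T. out_degree T v) = 0"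
      by (metis of_nat_eq_0_iff of_nat_sum)
    then have "lam = 0"
      by (simp add: assms(6,7) average_degree_sequence del: sum_eq_0_iff)
    moreover have "\<eta> = 0"
      using True assms(8) by simp
    moreover have "0 \<le> ?S"
      by (simp add: sum_nonneg)
    ultimately show ?thesis
      using assms(9) by simp
  next
    case False
    then have n: "n = m + 1" and m: "m \<ge> 1"
      using assms(4) by simp_all
    have ne: "verts T \<noteq> {}"
      using n assms(2) by auto
    have lam_le: "lam \<le> real \<Delta>"
      using average_degree_sequence_le_max_degree[OF ne] assms(5-7) by simp
    \<comment> \<open>The average degree 2m / n is positive and bounds \<open>\<Delta>\<close> from
      below.\<close>
    have "\<Delta> \<ge> 1"
    proof (rule ccontr)
      assume "\<not> \<Delta> \<ge> 1"
      then have "lam \<le> 0"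
        using lam_le by simp
      moreover have "real (\<Sum>v\<in>verts T. out_degree T v) = 2 * real m"
        using handshake assms(3)
        by (metis of_int_of_nat_eq of_nat_eq_iff of_nat_mult of_nat_numeral of_nat_sum)
      ultimately show False
        using m n assms(2)
        by (simp add: assms(6,7) average_degree_sequence divide_le_0_iff del: of_nat_sum)
    qed
    \<comment> \<open>As n / m \<ge> 1, it follows that \<eta> \<ge> 2 \<Delta> > \<Delta> \<ge>
      lam. So the second quotient is positive and its ceiling is at least 1.\<close>
    have "real m * real \<Delta> \<le> real n * real \<Delta>"
      using n by (intro mult_right_mono) auto
    then have "2 * real \<Delta> \<le> 2 * real n * real \<Delta> / real m"
      using m by (simp add: le_divide_eq mult_ac)
    then have "2 * real \<Delta> \<le> real_of_int \<eta>"
      unfolding assms(8) by linarith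
    then have "real_of_int \<eta> - lam > 0"
      using lam_le \<open>\<Delta> \<ge> 1\<close> by linarith
    then have "?C \<ge> 1"
      using n by (simp add: one_le_ceiling)
    then have C: "\<eta>\<^sub>1 \<le> \<eta>\<^sub>1 * ?C"
      using assms(9) by simp
    \<comment> \<open>Substituting n = m + 1 turns -10 m + 4 n into -6 m + 4.\<close>
    have sigma: "sigma_index T \<le> ?S - 6 * int m + 4"
      using sigma_index_le assms(2,3) n by simp
    show ?thesis
    proof (cases "m = 1")
      case True
      \<comment> \<open>With n = 2 the general bound -2 on the floor would leave
        \<open>- \<eta>\<^sub>1\<close>, which is below the -2 provided by \<open>sigma\<close>.
        Since \<eta> \<ge> 4, the denominator is at most -2 and the floor at least -1, which the
        ceiling term cancels.\<close>
      have "real_of_int \<eta> \<ge> 4"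
        using \<open>\<Delta> \<ge> 1\<close> True n unfolding assms(8) by simp
      then have "-1 \<le> real n / (real n - real_of_int \<eta>)"
        using True n by (simp add: le_divide_eq)
      then have "-1 \<le> ?F"
        by (simp add: le_floor_iff)
      then have "\<eta>\<^sub>1 * -1 \<le> \<eta>\<^sub>1 * ?F"
        using assms(9) by (intro mult_left_mono) auto
      then show ?thesis
        using C sigma True by linarith
    next
      case False
      \<comment> \<open>One of the n copies of \<open>\<eta>\<^sub>1\<close> lost to the floor is
        recovered by the ceiling, so at most \<open>\<eta>\<^sub>1 * int m\<close>, hence at most 4
        m, is lost. This fits into 6 m - 4 exactly when m \<ge> 2.\<close>
      have "- int n \<le> ?F"
        using floor_divide_of_int_ge[of n "int n - \<eta>"] by simp
      then have "\<eta>\<^sub>1 * - int n \<le> \<eta>\<^sub>1 * ?F"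
        using assms(9) by (intro mult_left_mono) auto
      moreover have "\<eta>\<^sub>1 * - int n = - (\<eta>\<^sub>1 * int m) - \<eta>\<^sub>1"
        by (simp add: n algebra_simps)
      moreover have "\<eta>\<^sub>1 * int m \<le> 4 * int m"
        using assms(10) by (intro mult_right_mono) auto
      ultimately show ?thesis
        using C sigma False m by linarith
    qed
  qed
qed

end
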